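(* Let $f(\cdot,\cdot)$ be a Lipschitz neural network of depth $T$ with constants $S,U,B,X$ (as defined in the context). Then for every $1\le t\le T+1$, every $\theta\in\Theta$ and every $x\in\mathcal X$, $$\left\|\frac{\partial f(\theta,x)}{\partial b_t}\right\|_2\le (SU)^{T+1-t},\qquad \left\|\frac{\partial f(\theta,x)}{\partial W_t}\right\|_2\le (SU)^{T+1-t}\,\|h_{t-1}(x)\| .$$ In particular, for every $x\in\mathcal X$, the function $\theta\mapsto f(\theta,x)$ is Lipschitz on $\Theta$ (with a finite Lipschitz constant).
   Context: A feedforward network of depth $T$ is the map $f:\Theta\times\mathcal X\to\mathbb R^{k}$ given by $h_0(x)=x$, $z_t(x)=W_th_{t-1}(x)+b_t$ for $1\le t\le T+1$, $h_t(x)=\sigma(z_t(x))$ for $1\le t\le T$, and $f(\theta,x)=z_{T+1}(x)$, where $\theta=(W_t,b_t)_{1\le t\le T+1}$, the $W_t$ are real matrices and the $b_t$ real vectors of compatible sizes, and $\sigma$ is an activation map $\mathbb R^n\to\mathbb R^n$ (one for each layer width $n$). It is called a Lipschitz neural network with constants $S,U>0$ if $\sigma$ is $S$-Lipschitz for the Euclidean norm and every $\theta\in\Theta$ satisfies $\|W_t\|_2\le U$ (spectral norm) for all $t$. Standing assumptions: inputs are bounded, $\|x\|\le X$ for all $x\in\mathcal X$; biases are bounded, $\|b_t\|\le B$ for all $t$ and all $\theta\in\Theta$; the activation preserves zero, $\sigma(\mathbf 0)=\mathbf 0$. The norm of a Jacobian is its spectral (operator) norm, where the space of parameters $W_t$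 carries the Euclidean (Frobenius) norm and vectors carry the Euclidean norm. Jacobians are understood (via the chain rule) at points where $\sigma$ is differentiable. *)

theory Defs
  imports "Jordan_Normal_Form.Matrix" "HOL-Analysis.L2_Norm"
begin

definition vec_norm :: "real vec \<Rightarrow> real" where
  "vec_norm v = L2_set (\<lambda>i. v $ i) {..<dim_vec v}"

definition spectral_norm :: "real mat \<Rightarrow> real" where
  "spectral_norm A =
     (SUP v \<in> {v \<in> carrier_vec (dim_col A). vec_norm v \<le> 1}. vec_norm (A *\<^sub>v v))"

(* Row-major identification of m x n matrices with R^(m*n).  It is an isometry from the
   Frobenius norm to the Euclidean norm, so the spectral norm of a Jacobian taken with respect
   to vec_of_mat A is its operator norm for the Frobenius norm on the matrix argument A. *)

definition vec_of_mat :: "real mat \<Rightarrow> real vec" where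
  "vec_of_mat A =
     vec (dim_row A * dim_col A) (\<lambda>k. A $$ (k div dim_col A, k mod dim_col A))"

definition mat_of_vec :: "nat \<Rightarrow> nat \<Rightarrow> real vec \<Rightarrow> real mat" where
  "mat_of_vec m n v = mat m n (\<lambda>(i, j). v $ (i * n + j))"

(* has_jacobian F J x: on the space R^n containing x, the map F takes values in one R^m and is
   Frechet differentiable at x, with Jacobian matrix J. *)

definition has_jacobian :: "(real vec \<Rightarrow> real vec) \<Rightarrow> real mat \<Rightarrow> real vec \<Rightarrow> bool" where
  "has_jacobian F J x \<longleftrightarrow>
     F ` carrier_vec (dim_vec x) \<subseteq> carrier_vec (dim_vec (F x)) \<and>
     J \<in> carrier_mat (dim_vec (F x)) (dim_vec x) \<and>
     (\<forall>e>0. \<exists>d>0. \<forall>y \<in> carrier_vec (dim_vec x). vec_norm (y - x) < d \<longrightarrow>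
        vec_norm (F y - F x - J *\<^sub>v (y - x)) \<le> e * vec_norm (y - x))"

(* The type "real vec" comprises the vectors of all dimensions, so a single function s stands
   for the family of activation maps R^n -> R^n, one for each n.  A parameter (W, b) consists of
   the weights W t and the biases b t; only the indices 1, ..., T + 1 matter. *)

type_synonym params = "(nat \<Rightarrow> real mat) \<times> (nat \<Rightarrow> real vec)"

primrec hidden :: "(real vec \<Rightarrow> real vec) \<Rightarrow> params \<Rightarrow> real vec \<Rightarrow> nat \<Rightarrow> real vec" where
  "hidden s \<theta> x 0 = x"
| "hidden s \<theta> x (Suc t) = s (fst \<theta> (Suc t) *\<^sub>v hidden s \<theta> x t + snd \<theta> (Suc t))"

definition preact :: "(real vec \<Rightarrow> real vec) \<Rightarrow> params \<Rightarrow> real vec \<Rightarrow> nat \<Rightarrow> real vec" where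
  "preact s \<theta> x t = fst \<theta> t *\<^sub>v hidden s \<theta> x (t - 1) + snd \<theta> t"

definition network :: "nat \<Rightarrow> (real vec \<Rightarrow> real vec) \<Rightarrow> params \<Rightarrow> real vec \<Rightarrow> real vec" where
  "network T s \<theta> x = preact s \<theta> x (T + 1)"

(* The widths n 0, ..., n (T + 1) are those of the input, the hidden layers and the output. *)

definition lipschitz_network ::
  "nat \<Rightarrow> (nat \<Rightarrow> nat) \<Rightarrow> (real vec \<Rightarrow> real vec) \<Rightarrow> params set \<Rightarrow> real vec set
     \<Rightarrow> real \<Rightarrow> real \<Rightarrow> real \<Rightarrow> real \<Rightarrow> bool" where
  "lipschitz_network T n s \<Theta> \<X> S U B X \<longleftrightarrow>
     S > 0 \<and> U > 0 \<and>
     (\<forall>t \<in> {1..T}.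
        s ` carrier_vec (n t) \<subseteq> carrier_vec (n t) \<and>
        s (0\<^sub>v (n t)) = 0\<^sub>v (n t) \<and>
        (\<forall>u \<in> carrier_vec (n t). \<forall>v \<in> carrier_vec (n t).
           vec_norm (s u - s v) \<le> S * vec_norm (u - v))) \<and>
     (\<forall>(W, b) \<in> \<Theta>. \<forall>t \<in> {1..T + 1}.
        W t \<in> carrier_mat (n t) (n (t - 1)) \<and> b t \<in> carrier_vec (n t) \<and>
        spectral_norm (W t) \<le> U \<and> vec_norm (b t) \<le> B) \<and>
     (\<forall>x \<in> \<X>. x \<in> carrier_vec (n 0) \<and> vec_norm x \<le> X)"

definition params_dist :: "nat \<Rightarrow> params \<Rightarrow> params \<Rightarrow> real" where
  "params_dist T \<theta> \<theta>' = sqrt (\<Sum>t = 1..T + 1.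
     (vec_norm (vec_of_mat (fst \<theta> t - fst \<theta>' t)))\<^sup>2 + (vec_norm (snd \<theta> t - snd \<theta>' t))\<^sup>2)"

end

theory Submission
  imports Defs
begin

text \<open>
  The preactivation of layer \<open>t\<close> is affine in \<open>b\<^sub>t\<close>, with the identity as linear part, and affine in
  \<open>W\<^sub>t\<close>, with linear part \<open>A \<mapsto> A h\<^sub>t\<^sub>-\<^sub>1\<close>, which is bounded by \<open>\<parallel>h\<^sub>t\<^sub>-\<^sub>1\<parallel>\<close> for the Frobenius norm. By the
  chain rule every further layer multiplies the Jacobian from the left by \<open>W\<^sub>r\<^sub>+\<^sub>1 D\<close>, where \<open>D\<close> is the
  Jacobian of the activation at a preactivation; since the activation is \<open>S\<close>-Lipschitz, \<open>D\<close> is bounded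
  by \<open>S\<close>, so each layer contributes a factor of at most \<open>SU\<close>. The global Lipschitz bound is proved by
  induction on the layer instead of from the Jacobians, because the activation need not be
  differentiable and \<open>\<Theta>\<close> need not be convex; it splits
  \<open>W h - W' h' = W (h - h') + (W - W') h'\<close> and uses that the hidden states are uniformly bounded.
\<close>

section \<open>Euclidean norm, operator bounds and the spectral norm\<close>

lemma vec_norm_nonneg [simp]: "0 \<le> vec_norm v"
  by (simp add: vec_norm_def)

lemma vec_norm_zero [simp]: "vec_norm (0\<^sub>v k) = 0"
  by (simp add: vec_norm_def L2_set_def)

lemma vec_norm_power2: "(vec_norm v)\<^sup>2 = (\<Sum>i<dim_vec v. (v $ i)\<^sup>2)"
  by (simp add: vec_norm_def L2_set_def sum_nonneg)

lemma vec_norm_smult: "vec_norm (c \<cdot>\<^sub>v v) = \<bar>c\<bar> * vec_norm v"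
proof -
  have "(\<Sum>i<dim_vec v. ((c \<cdot>\<^sub>v v) $ i)\<^sup>2) = c\<^sup>2 * (\<Sum>i<dim_vec v. (v $ i)\<^sup>2)"
    by (simp add: sum_distrib_left power_mult_distrib)
  then show ?thesis
    by (simp add: vec_norm_def L2_set_def real_sqrt_mult)
qed

lemma vec_norm_add_le:
  assumes "u \<in> carrier_vec k" "v \<in> carrier_vec k"
  shows "vec_norm (u + v) \<le> vec_norm u + vec_norm v"
proof -
  have "vec_norm (u + v) = L2_set (\<lambda>i. u $ i + v $ i) {..<k}"
    using assms by (auto simp: vec_norm_def intro!: L2_set_cong)
  also have "\<dots> \<le> L2_set (\<lambda>i. u $ i) {..<k} + L2_set (\<lambda>i. v $ i) {..<k}"
    by (rule L2_set_triangle_ineq)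
  finally show ?thesis
    using assms by (auto simp: vec_norm_def)
qed

text \<open>The range below \<open>m * k\<close> splits into \<open>m\<close> consecutive blocks of
  length \<open>k\<close>, and in block \<open>i\<close> the index \<open>i * k + j\<close> is
  decoded by \<open>div\<close> and \<open>mod\<close> as \<open>(i, j)\<close>. This makes precise
  that flattening is an isometry for the Frobenius norm.\<close>

lemma vec_norm_vec_of_mat_power2:
  assumes "A \<in> carrier_mat m k"
  shows "(vec_norm (vec_of_mat A))\<^sup>2 = (\<Sum>i<m. \<Sum>j<k. (A $$ (i, j))\<^sup>2)"
proof -
  have "(vec_norm (vec_of_mat A))\<^sup>2 = (\<Sum>l<m * k. (A $$ (l div k, l mod k))\<^sup>2)"
    using assms by (simp add: vec_norm_power2 vec_of_mat_def)
  also have "\<dots> = (\<Sum>i<m. \<Sum>l = i * k..<i * k + k. (A $$ (l div k, l mod k))\<^sup>2)"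
    by (rule sum.nat_group [symmetric])
  also have "\<dots> = (\<Sum>i<m. \<Sum>j<k. (A $$ (i, j))\<^sup>2)"
  proof (rule sum.cong [OF refl])
    fix i
    show "(\<Sum>l = i * k..<i * k + k. (A $$ (l div k, l mod k))\<^sup>2) = (\<Sum>j<k. (A $$ (i, j))\<^sup>2)"
      using sum.shift_bounds_nat_ivl [of "\<lambda>l. (A $$ (l div k, l mod k))\<^sup>2" 0 "i * k" k]
      by (simp add: add.commute lessThan_atLeast0)
  qed
  finally show ?thesis .
qed

text \<open>Cauchy-Schwarz in each row, then summation over the rows. It supplies a finite operator
  bound for an arbitrary matrix, and later controls both the weight Jacobian and the term
  \<open>(W - W') h'\<close>.\<close>

lemma vec_norm_mult_mat_vec_le_frobenius:
  assumes A: "A \<in> carrier_mat m k" and v: "v \<in> carrier_vec k"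
  shows "vec_norm (A *\<^sub>v v) \<le> vec_norm (vec_of_mat A) * vec_norm v"
proof (rule power2_le_imp_le)
  have row: "((A *\<^sub>v v) $ i)\<^sup>2 \<le> (\<Sum>j<k. (A $$ (i, j))\<^sup>2) * (vec_norm v)\<^sup>2" if "i < m" for i
  proof -
    have "(A *\<^sub>v v) $ i = (\<Sum>j<k. A $$ (i, j) * v $ j)"
      using A v that by (auto simp: scalar_prod_def lessThan_atLeast0)
    also have "\<bar>\<dots>\<bar> \<le> (\<Sum>j<k. \<bar>A $$ (i, j)\<bar> * \<bar>v $ j\<bar>)"
      using sum_abs [of "\<lambda>j. A $$ (i, j) * v $ j" "{..<k}"] by (simp add: abs_mult)
    also have "\<dots> \<le> L2_set (\<lambda>j. A $$ (i, j)) {..<k} * L2_set (\<lambda>j. v $ j) {..<k}"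
      by (rule L2_set_mult_ineq)
    finally have "\<bar>(A *\<^sub>v v) $ i\<bar> \<le> L2_set (\<lambda>j. A $$ (i, j)) {..<k} * vec_norm v"
      using v by (auto simp: vec_norm_def)
    then have "((A *\<^sub>v v) $ i)\<^sup>2 \<le> (L2_set (\<lambda>j. A $$ (i, j)) {..<k} * vec_norm v)\<^sup>2"
      using abs_le_square_iff by (metis abs_le_D1 abs_of_nonneg order_trans abs_ge_zero)
    then show ?thesis
      by (simp add: power_mult_distrib L2_set_def sum_nonneg)
  qed
  have "(vec_norm (A *\<^sub>v v))\<^sup>2 = (\<Sum>i<m. ((A *\<^sub>v v) $ i)\<^sup>2)"
    using A by (simp add: vec_norm_power2)
  also have "\<dots> \<le> (\<Sum>i<m. (\<Sum>j<k. (A $$ (i, j))\<^sup>2) * (vec_norm v)\<^sup>2)"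
    by (intro sum_mono row) simp
  also have "\<dots> = (vec_norm (vec_of_mat A) * vec_norm v)\<^sup>2"
    by (simp add: vec_norm_vec_of_mat_power2 [OF A] power_mult_distrib sum_distrib_right)
  finally show "(vec_norm (A *\<^sub>v v))\<^sup>2 \<le> (vec_norm (vec_of_mat A) * vec_norm v)\<^sup>2" .
qed simp

text \<open>Used in place of the spectral norm, whose supremum would have to be shown bounded each time.\<close>

definition mat_bounded :: "real mat \<Rightarrow> real \<Rightarrow> bool" where
  "mat_bounded A c \<longleftrightarrow> (\<forall>v \<in> carrier_vec (dim_col A). vec_norm (A *\<^sub>v v) \<le> c * vec_norm v)"

lemma mat_boundedD:
  "mat_bounded A c \<Longrightarrow> A \<in> carrier_mat m k \<Longrightarrow> v \<in> carrier_vec k \<Longrightarrow>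
    vec_norm (A *\<^sub>v v) \<le> c * vec_norm v"
  by (auto simp: mat_bounded_def)

lemma mat_bounded_frobenius: "mat_bounded A (vec_norm (vec_of_mat A))"
  using vec_norm_mult_mat_vec_le_frobenius [of A "dim_row A" "dim_col A"]
  by (auto simp: mat_bounded_def)

lemma mat_bounded_mult:
  assumes "A \<in> carrier_mat m k" "B \<in> carrier_mat k l" "mat_bounded A a" "mat_bounded B b" "0 \<le> a"
  shows "mat_bounded (A * B) (a * b)"
  unfolding mat_bounded_def
proof
  fix v :: "real vec" assume "v \<in> carrier_vec (dim_col (A * B))"
  then have v: "v \<in> carrier_vec l" using assms by simp
  have "vec_norm ((A * B) *\<^sub>v v) = vec_norm (A *\<^sub>v (B *\<^sub>v v))"
    using assms v by (simp add: assoc_mult_mat_vec [of _ m k _ l])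
  also have "\<dots> \<le> a * vec_norm (B *\<^sub>v v)"
    using mat_boundedD [OF assms(3,1)] assms(2) v by simp
  also have "\<dots> \<le> a * (b * vec_norm v)"
    using mat_boundedD [OF assms(4,2) v] assms(5) by (rule mult_left_mono)
  finally show "vec_norm ((A * B) *\<^sub>v v) \<le> a * b * vec_norm v" by simp
qed

lemma spectral_norm_le:
  assumes "mat_bounded A c" "0 \<le> c"
  shows "spectral_norm A \<le> c"
  unfolding spectral_norm_def
proof (rule cSUP_least)
  show "{v \<in> carrier_vec (dim_col A). vec_norm v \<le> 1} \<noteq> {}"
    by (auto intro: exI [of _ "0\<^sub>v (dim_col A)"])
next
  fix v assume "v \<in> {v \<in> carrier_vec (dim_col A). vec_norm v \<le> 1}"
  then have "vec_norm (A *\<^sub>v v) \<le> c * vec_norm v" "c * vec_norm v \<le> c"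
    using assms by (auto simp: mat_bounded_def mult_left_le)
  then show "vec_norm (A *\<^sub>v v) \<le> c" by linarith
qed

text \<open>By homogeneity it suffices to treat vectors scaled to length 1. That the real-valued
  \<open>SUP\<close> dominates their images requires the set of images to be bounded above, which
  the Frobenius bound ensures.\<close>

lemma mat_bounded_if_spectral_norm_le:
  assumes "spectral_norm A \<le> c"
  shows "mat_bounded A c"
  unfolding mat_bounded_def
proof
  fix v :: "real vec" assume v: "v \<in> carrier_vec (dim_col A)"
  let ?S = "{v \<in> carrier_vec (dim_col A). vec_norm v \<le> 1}"
  have frob: "vec_norm (A *\<^sub>v u) \<le> vec_norm (vec_of_mat A) * vec_norm u"
    if "u \<in> carrier_vec (dim_col A)" for u
    using mat_bounded_frobenius that by (simp add: mat_bounded_def)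
  have bdd: "bdd_above ((\<lambda>u. vec_norm (A *\<^sub>v u)) ` ?S)"
    by (rule bdd_aboveI [of _ "vec_norm (vec_of_mat A)"])
       (auto intro: order_trans [OF frob] simp: mult_left_le)
  show "vec_norm (A *\<^sub>v v) \<le> c * vec_norm v"
  \<comment> \<open>A vector of norm 0 cannot be normalized; for it the Frobenius bound already
    forces the image to have norm 0.\<close>
  proof (cases "vec_norm v = 0")
    case True
    then show ?thesis using frob [OF v] by simp
  next
    case False
    then have pos: "0 < vec_norm v" using vec_norm_nonneg [of v] by linarith
    let ?u = "inverse (vec_norm v) \<cdot>\<^sub>v v"
    have "?u \<in> ?S" using v pos by (simp add: vec_norm_smult)
    then have "vec_norm (A *\<^sub>v ?u) \<le> spectral_norm A"
      unfolding spectral_norm_def using bdd by (rule cSUP_upper)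
    moreover have "A *\<^sub>v ?u = inverse (vec_norm v) \<cdot>\<^sub>v (A *\<^sub>v v)"
      using v by (metis carrier_matI mult_mat_vec)
    ultimately have "inverse (vec_norm v) * vec_norm (A *\<^sub>v v) \<le> c"
      using assms pos by (simp add: vec_norm_smult)
    then show ?thesis using pos by (simp add: field_simps)
  qed
qed

section \<open>Jacobians: affine maps, chain rule, Lipschitz maps\<close>

text \<open>The remainder vanishes identically, so every radius works; 1 is taken.\<close>

lemma has_jacobian_affine:
  assumes A: "A \<in> carrier_mat m k" and b: "b \<in> carrier_vec m" and x: "x \<in> carrier_vec k"
    and F: "\<And>y. y \<in> carrier_vec k \<Longrightarrow> F y = A *\<^sub>v y + b"
  shows "has_jacobian F A x"
proof -
  have "F y - F x - A *\<^sub>v (y - x) = 0\<^sub>v m" if y: "y \<in> carrier_vec k" for y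
    using A b x y by (simp add: F mult_minus_distrib_mat_vec [OF A y x] del: mult_mat_vec_carrier)
       (rule eq_vecI, auto)
  then show ?thesis
    unfolding has_jacobian_def using assms
    by (auto intro!: exI [of _ 1])
qed

text \<open>The remainder of the composition is the remainder of \<open>G\<close> at
  \<open>F x\<close> plus \<open>K\<close> applied to the remainder of \<open>F\<close>. The first
  is small relative to \<open>y - x\<close> because \<open>F y - F x\<close> grows at most linearly
  in it, the second because \<open>K\<close> is bounded.\<close>

lemma has_jacobian_compose:
  assumes F: "has_jacobian F J x" and G: "has_jacobian G K (F x)"
  shows "has_jacobian (\<lambda>y. G (F y)) (K * J) x"
proof -
  define k m l where "k = dim_vec x" and "m = dim_vec (F x)" and "l = dim_vec (G (F x))"
  have x: "x \<in> carrier_vec k" and Fc: "\<And>y. y \<in> carrier_vec k \<Longrightarrow> F y \<in> carrier_vec m"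
    and Gc: "\<And>y. y \<in> carrier_vec m \<Longrightarrow> G y \<in> carrier_vec l"
    and J: "J \<in> carrier_mat m k" and K: "K \<in> carrier_mat l m"
    using F G by (auto simp: has_jacobian_def k_def m_def l_def)
  define a where "a = vec_norm (vec_of_mat J)"
  define c where "c = vec_norm (vec_of_mat K)"
  have a: "0 \<le> a" "mat_bounded J a" and c: "0 \<le> c" "mat_bounded K c"
    by (auto simp: a_def c_def mat_bounded_frobenius)
  have "\<exists>d>0. \<forall>y \<in> carrier_vec k. vec_norm (y - x) < d \<longrightarrow>
      vec_norm (G (F y) - G (F x) - (K * J) *\<^sub>v (y - x)) \<le> e * vec_norm (y - x)" if "0 < e" for e
  proof -
    \<comment> \<open>Each of the two remainders is to use up half of \<open>e\<close>:
      \<open>c * e1\<close> is at most \<open>e / 2\<close>, and \<open>e2 * (a + 1)\<close> equals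
      \<open>e / 2\<close>. Adding 1 to \<open>a\<close> and \<open>c\<close> keeps the denominators
      positive when these norms are 0; \<open>e1 \<le> 1\<close> yields the growth factor
      \<open>a + 1\<close> for \<open>F\<close>.\<close>
    define e1 where "e1 = min 1 (e / (2 * (c + 1)))"
    define e2 where "e2 = e / (2 * (a + 1))"
    have e1: "0 < e1" "e1 \<le> 1" and e2: "0 < e2"
      using that a c by (auto simp: e1_def e2_def)
    have "c * e1 \<le> (c + 1) * (e / (2 * (c + 1)))"
      using c that by (intro mult_mono) (auto simp: e1_def)
    also have "\<dots> = e / 2" using c by (simp add: field_simps)
    finally have ce1: "c * e1 \<le> e / 2" .
    have ae2: "e2 * (a + 1) = e / 2" using a by (simp add: e2_def field_simps)
    obtain d1 where d1: "0 < d1" and Fd: "\<And>y. y \<in> carrier_vec k \<Longrightarrow> vec_norm (y - x) < d1 \<Longrightarrow>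
        vec_norm (F y - F x - J *\<^sub>v (y - x)) \<le> e1 * vec_norm (y - x)"
      using F e1 unfolding has_jacobian_def k_def by meson
    obtain d2 where d2: "0 < d2" and Gd: "\<And>z. z \<in> carrier_vec m \<Longrightarrow> vec_norm (z - F x) < d2 \<Longrightarrow>
        vec_norm (G z - G (F x) - K *\<^sub>v (z - F x)) \<le> e2 * vec_norm (z - F x)"
      using G e2 unfolding has_jacobian_def m_def by meson
    show ?thesis
    \<comment> \<open>The second radius keeps \<open>F y\<close> within distance \<open>d2\<close>
      of \<open>F x\<close>, since \<open>F\<close> stretches by at most \<open>a + 1\<close> near
      \<open>x\<close>.\<close>
    proof (intro exI [of _ "min d1 (d2 / (a + 1))"] conjI ballI impI)
      show "0 < min d1 (d2 / (a + 1))" using d1 d2 a by simp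
    next
      fix y assume y: "y \<in> carrier_vec k" and yd: "vec_norm (y - x) < min d1 (d2 / (a + 1))"
      let ?h = "y - x" and ?g = "F y - F x"
      have h: "?h \<in> carrier_vec k" and g: "?g \<in> carrier_vec m"
        using x y Fc by auto
      have Jh: "J *\<^sub>v ?h \<in> carrier_vec m" using J h by simp
      have r: "vec_norm (?g - J *\<^sub>v ?h) \<le> e1 * vec_norm ?h" using Fd y yd by simp
      have "vec_norm ?g = vec_norm ((?g - J *\<^sub>v ?h) + J *\<^sub>v ?h)"
        using g Jh Fc [OF x] J by (intro arg_cong [of _ _ vec_norm]) (rule eq_vecI, auto)
      also have "\<dots> \<le> vec_norm (?g - J *\<^sub>v ?h) + vec_norm (J *\<^sub>v ?h)"
        using g Jh by (intro vec_norm_add_le) auto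
      also have "\<dots> \<le> e1 * vec_norm ?h + a * vec_norm ?h"
        using r mat_boundedD [OF a(2) J h] by (rule add_mono)
      also have "\<dots> \<le> (a + 1) * vec_norm ?h"
        using mult_right_mono [OF e1(2) vec_norm_nonneg [of ?h]] by (simp add: algebra_simps)
      finally have gle: "vec_norm ?g \<le> (a + 1) * vec_norm ?h" .
      also have "\<dots> < d2" using yd a by (simp add: field_simps)
      finally have gd2: "vec_norm ?g < d2" .
      have Ge: "vec_norm (G (F y) - G (F x) - K *\<^sub>v ?g) \<le> e2 * vec_norm ?g"
        using Gd [OF Fc [OF y] gd2] .
      have GF: "G (F y) \<in> carrier_vec l" "G (F x) \<in> carrier_vec l" "K *\<^sub>v ?g \<in> carrier_vec l"
        "K *\<^sub>v (J *\<^sub>v ?h) \<in> carrier_vec l" using Gc Fc x y K g Jh by auto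
      have "(K * J) *\<^sub>v ?h = K *\<^sub>v (J *\<^sub>v ?h)"
        using K J h by (rule assoc_mult_mat_vec)
      moreover have "K *\<^sub>v (?g - J *\<^sub>v ?h) = K *\<^sub>v ?g - K *\<^sub>v (J *\<^sub>v ?h)"
        using K g Jh by (rule mult_minus_distrib_mat_vec)
      ultimately have "G (F y) - G (F x) - (K * J) *\<^sub>v ?h =
          (G (F y) - G (F x) - K *\<^sub>v ?g) + K *\<^sub>v (?g - J *\<^sub>v ?h)"
        using GF by (intro eq_vecI) auto
      then have "vec_norm (G (F y) - G (F x) - (K * J) *\<^sub>v ?h) \<le>
          vec_norm (G (F y) - G (F x) - K *\<^sub>v ?g) + vec_norm (K *\<^sub>v (?g - J *\<^sub>v ?h))"
        using GF K g Jh by (simp add: vec_norm_add_le [of _ l])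
      also have "\<dots> \<le> e2 * vec_norm ?g + c * vec_norm (?g - J *\<^sub>v ?h)"
        using Ge mat_boundedD [OF c(2) K] g Jh by (intro add_mono) auto
      also have "\<dots> \<le> e2 * ((a + 1) * vec_norm ?h) + c * (e1 * vec_norm ?h)"
        using gle r e2 c by (intro add_mono mult_left_mono) auto
      also have "\<dots> = (e2 * (a + 1)) * vec_norm ?h + (c * e1) * vec_norm ?h" by simp
      also have "\<dots> \<le> e / 2 * vec_norm ?h + e / 2 * vec_norm ?h"
        using ae2 ce1 by (intro add_mono mult_right_mono) auto
      finally show "vec_norm (G (F y) - G (F x) - (K * J) *\<^sub>v (y - x)) \<le> e * vec_norm (y - x)"
        by simp
    qed
  qed
  then show ?thesis
    unfolding has_jacobian_def using Fc Gc J K x by (auto simp flip: k_def m_def l_def)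
qed

text \<open>\<open>D *\<^sub>v v\<close> is the limit of the difference quotients of
  \<open>s\<close> at \<open>z\<close> in direction \<open>v\<close>, and each of these has norm at
  most \<open>S * vec_norm v\<close>. Instead of passing to a limit, one sufficiently small step
  \<open>h\<close> gives the bound up to an arbitrary slack \<open>e\<close>.\<close>

lemma jacobian_bounded_if_lipschitz:
  assumes s: "has_jacobian s D z" and z: "z \<in> carrier_vec k"
    and lip: "\<And>u v. u \<in> carrier_vec k \<Longrightarrow> v \<in> carrier_vec k \<Longrightarrow>
      vec_norm (s u - s v) \<le> S * vec_norm (u - v)"
  shows "mat_bounded D S"
  unfolding mat_bounded_def
proof
  define m where "m = dim_vec (s z)"
  have D: "D \<in> carrier_mat m k" and sc: "\<And>y. y \<in> carrier_vec k \<Longrightarrow> s y \<in> carrier_vec m"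
    using s z by (auto simp: has_jacobian_def m_def)
  fix v :: "real vec" assume "v \<in> carrier_vec (dim_col D)"
  then have v: "v \<in> carrier_vec k" using D by simp
  have "vec_norm (D *\<^sub>v v) \<le> S * vec_norm v + e" if "0 < e" for e
  proof -
    \<comment> \<open>\<open>q\<close> exceeds \<open>vec_norm v\<close> and is positive even for
      \<open>v = 0\<close>. Hence the step \<open>h = d / q\<close> moves \<open>z\<close> by less
      than \<open>d\<close>, and the relative error \<open>e / q\<close> costs at most
      \<open>e\<close> in the end.\<close>
    define q where "q = vec_norm v + 1"
    have q: "0 < q" "vec_norm v < q" using vec_norm_nonneg [of v] by (auto simp: q_def add_nonneg_pos)
    have eq: "0 < e / q" using that q by simp
    obtain d where d: "0 < d" and sd: "\<And>y. y \<in> carrier_vec k \<Longrightarrow> vec_norm (y - z) < d \<Longrightarrow>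
        vec_norm (s y - s z - D *\<^sub>v (y - z)) \<le> e / q * vec_norm (y - z)"
      using s z eq unfolding has_jacobian_def by (metis carrier_vecD)
    define h where "h = d / q"
    have h: "0 < h" using d q by (simp add: h_def)
    let ?y = "z + h \<cdot>\<^sub>v v"
    have y: "?y \<in> carrier_vec k" using z v by simp
    have yz: "?y - z = h \<cdot>\<^sub>v v" using z v by (intro eq_vecI) auto
    have "vec_norm (?y - z) < d"
      using h q d by (simp add: yz vec_norm_smult) (simp add: h_def field_simps)
    note err = sd [OF y this, unfolded yz]
    have l: "vec_norm (s ?y - s z) \<le> S * (h * vec_norm v)"
      using lip [OF y z] h by (simp add: yz vec_norm_smult)
    have Dv: "D *\<^sub>v (h \<cdot>\<^sub>v v) = h \<cdot>\<^sub>v (D *\<^sub>v v)" using D v by (rule mult_mat_vec)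
    have c: "s ?y \<in> carrier_vec m" "s z \<in> carrier_vec m" "D *\<^sub>v v \<in> carrier_vec m"
      using sc y z D v by auto
    have "h * vec_norm (D *\<^sub>v v) = vec_norm (h \<cdot>\<^sub>v (D *\<^sub>v v))"
      using h by (simp add: vec_norm_smult)
    \<comment> \<open>The linear term is the increment of \<open>s\<close> minus the remainder; the
      factor \<open>- 1\<close> turns the difference into a sum for the triangle inequality.\<close>
    also have "h \<cdot>\<^sub>v (D *\<^sub>v v) =
        (s ?y - s z) + (- 1) \<cdot>\<^sub>v (s ?y - s z - h \<cdot>\<^sub>v (D *\<^sub>v v))"
      using c by (intro eq_vecI) auto
    also have "vec_norm \<dots> \<le> vec_norm (s ?y - s z) +
        vec_norm ((- 1) \<cdot>\<^sub>v (s ?y - s z - h \<cdot>\<^sub>v (D *\<^sub>v v)))"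
      using c by (intro vec_norm_add_le [of _ m]) auto
    also have "\<dots> \<le> S * (h * vec_norm v) + e / q * (h * vec_norm v)"
      using l err h by (simp add: vec_norm_smult Dv)
    also have "\<dots> = h * (S * vec_norm v + e / q * vec_norm v)"
      by (simp add: algebra_simps)
    finally have "vec_norm (D *\<^sub>v v) \<le> S * vec_norm v + e / q * vec_norm v"
      using h by simp
    also have "e / q * vec_norm v \<le> e / q * q"
      using eq q by (intro mult_left_mono) auto
    finally show ?thesis using q by simp
  qed
  then show "vec_norm (D *\<^sub>v v) \<le> S * vec_norm v"
    by (rule field_le_epsilon)
qed

section \<open>Matrices as flattened vectors\<close>

lemma mat_of_vec_carrier [simp]: "mat_of_vec m k w \<in> carrier_mat m k"
  by (simp add: mat_of_vec_def)

lemma mat_index_less: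
  fixes i j m k :: nat
  assumes "i < m" "j < k"
  shows "i * k + j < m * k"
proof -
  have "i * k + j < Suc i * k" using assms by simp
  also have "\<dots> \<le> m * k" using assms by (intro mult_le_mono1) simp
  finally show ?thesis .
qed

lemma mat_of_vec_of_mat:
  assumes "A \<in> carrier_mat m k"
  shows "mat_of_vec m k (vec_of_mat A) = A"
  using assms by (intro eq_matI) (auto simp: mat_of_vec_def vec_of_mat_def mat_index_less)

lemma vec_of_mat_of_vec:
  assumes "w \<in> carrier_vec (m * k)"
  shows "vec_of_mat (mat_of_vec m k w) = w"
proof (rule eq_vecI)
  fix l assume "l < dim_vec w"
  then have l: "l < m * k" using assms by simp
  then have "l div k < m" by (simp add: less_mult_imp_div_less)
  \<comment> \<open>The case \<open>k = 0\<close> is impossible, because then no \<open>l\<close> is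
    below \<open>m * k\<close>.\<close>
  moreover have "l mod k < k" using l by (cases k) auto
  ultimately show "vec_of_mat (mat_of_vec m k w) $ l = w $ l"
    using l by (simp add: vec_of_mat_def mat_of_vec_def)
qed (use assms in \<open>simp add: vec_of_mat_def mat_of_vec_def\<close>)

text \<open>The witness is the Kronecker product of the identity of size \<open>m\<close> with the
  row vector \<open>h\<close>: row \<open>i\<close> carries \<open>h\<close> in block
  \<open>i\<close> and zeros elsewhere. Its bound is the Frobenius inequality for the reshaped
  matrix, whose Frobenius norm is the Euclidean norm of \<open>w\<close>.\<close>

lemma mat_of_vec_mult_vec_linear:
  assumes h: "h \<in> carrier_vec k"
  obtains J where "J \<in> carrier_mat m (m * k)" "mat_bounded J (vec_norm h)"
    "\<And>w. w \<in> carrier_vec (m * k) \<Longrightarrow> mat_of_vec m k w *\<^sub>v h = J *\<^sub>v w"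
proof
  let ?J = "mat m (m * k) (\<lambda>(i, l). if l div k = i then h $ (l mod k) else 0)"
  show J: "?J \<in> carrier_mat m (m * k)" by simp
  show eq: "mat_of_vec m k w *\<^sub>v h = ?J *\<^sub>v w" if w: "w \<in> carrier_vec (m * k)" for w
  proof (rule eq_vecI)
    fix i assume "i < dim_vec (?J *\<^sub>v w)"
    then have i: "i < m" by simp
    have "(?J *\<^sub>v w) $ i = (\<Sum>l<m * k. (if l div k = i then h $ (l mod k) else 0) * w $ l)"
      using i w by (auto simp: scalar_prod_def lessThan_atLeast0 intro!: sum.cong)
    \<comment> \<open>Only block \<open>i\<close> contributes; it is then reindexed by
      \<open>l = i * k + j\<close>.\<close>
    also have "\<dots> = (\<Sum>l\<in>{l. l < m * k \<and> l div k = i}. h $ (l mod k) * w $ l)"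
      by (rule sum.mono_neutral_cong_right) auto
    also have "\<dots> = (\<Sum>j<k. w $ (i * k + j) * h $ j)"
      by (rule sum.reindex_bij_witness [of _ "\<lambda>j. i * k + j" "\<lambda>l. l mod k"])
         (use i mat_index_less [of i m _ k] in \<open>auto simp: ac_simps\<close>, (cases k; simp)?)
    also have "\<dots> = (mat_of_vec m k w *\<^sub>v h) $ i"
      using i h by (auto simp: mat_of_vec_def scalar_prod_def lessThan_atLeast0 intro!: sum.cong)
    finally show "(mat_of_vec m k w *\<^sub>v h) $ i = (?J *\<^sub>v w) $ i" by simp
  qed (simp add: mat_of_vec_def)
  show "mat_bounded ?J (vec_norm h)"
    unfolding mat_bounded_def
  proof
    fix w :: "real vec" assume "w \<in> carrier_vec (dim_col ?J)"
    then have w: "w \<in> carrier_vec (m * k)" by simp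
    show "vec_norm (?J *\<^sub>v w) \<le> vec_norm h * vec_norm w"
      using vec_norm_mult_mat_vec_le_frobenius [of "mat_of_vec m k w" m k h] h
      by (simp add: eq [OF w] vec_of_mat_of_vec [OF w] mult.commute)
  qed
qed

section \<open>Layers of a Lipschitz network\<close>

lemma hidden_Suc_preact: "hidden s \<theta> x (Suc r) = s (preact s \<theta> x (Suc r))"
  by (simp add: preact_def)

text \<open>Used when only the parameters of layer \<open>t\<close> vary: the hidden state of layer
  \<open>t - 1\<close> then stays constant.\<close>

lemma hidden_cong:
  assumes "\<And>r. 1 \<le> r \<Longrightarrow> r \<le> t \<Longrightarrow> fst \<theta> r = fst \<theta>' r \<and> snd \<theta> r = snd \<theta>' r"
  shows "hidden s \<theta> x t = hidden s \<theta>' x t"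
  using assms by (induction t) auto

context
  fixes T n s \<Theta> \<X> S U B X
  assumes net: "lipschitz_network T n s \<Theta> \<X> S U B X"
begin

lemma net_pos: "0 < S" "0 < U"
  using net by (auto simp: lipschitz_network_def)

lemma activation_carrier: "1 \<le> t \<Longrightarrow> t \<le> T \<Longrightarrow> u \<in> carrier_vec (n t) \<Longrightarrow> s u \<in> carrier_vec (n t)"
  and activation_zero: "1 \<le> t \<Longrightarrow> t \<le> T \<Longrightarrow> s (0\<^sub>v (n t)) = 0\<^sub>v (n t)"
  and activation_lipschitz: "1 \<le> t \<Longrightarrow> t \<le> T \<Longrightarrow> u \<in> carrier_vec (n t) \<Longrightarrow> v \<in> carrier_vec (n t) \<Longrightarrow>
    vec_norm (s u - s v) \<le> S * vec_norm (u - v)"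
  using net unfolding lipschitz_network_def by (auto simp: image_subset_iff)

lemma layer:
  assumes "\<theta> \<in> \<Theta>" "1 \<le> t" "t \<le> T + 1"
  shows "fst \<theta> t \<in> carrier_mat (n t) (n (t - 1))" "snd \<theta> t \<in> carrier_vec (n t)"
    "mat_bounded (fst \<theta> t) U" "vec_norm (snd \<theta> t) \<le> B"
  using net assms unfolding lipschitz_network_def
  by (auto simp: mat_bounded_if_spectral_norm_le dest!: bspec [of \<Theta> _ \<theta>])

lemma input: "x \<in> \<X> \<Longrightarrow> x \<in> carrier_vec (n 0)"
  using net by (simp add: lipschitz_network_def)

lemma hidden_carrier:
  assumes "\<theta> \<in> \<Theta>" "x \<in> \<X>" "t \<le> T"
  shows "hidden s \<theta> x t \<in> carrier_vec (n t)"
  using assms(3)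
proof (induction t)
  case 0
  then show ?case using input assms by simp
next
  case (Suc t)
  then show ?case
    using layer [OF assms(1), of "Suc t"] by (auto intro!: activation_carrier)
qed

lemma preact_carrier:
  assumes "\<theta> \<in> \<Theta>" "x \<in> \<X>" "1 \<le> t" "t \<le> T + 1"
  shows "preact s \<theta> x t \<in> carrier_vec (n t)"
  using layer [OF assms(1,3,4)] hidden_carrier [OF assms(1,2), of "t - 1"] assms(4)
  by (auto simp: preact_def)

section \<open>Jacobians with respect to biases and weights\<close>

text \<open>The family \<open>\<theta>\<close> passes through \<open>(W, b)\<close> at
  \<open>p\<close> and agrees with it above layer \<open>t\<close>, which covers varying a bias and
  varying a weight matrix at once. Members of the family other than \<open>(W, b)\<close> may lie
  outside \<open>\<Theta>\<close>; the bound \<open>U\<close> is only applied to the fixed weights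
  above layer \<open>t\<close>. The induction starts at layer \<open>t\<close> with the bound
  \<open>c\<close>.\<close>

lemma preact_jacobian_propagate:
  assumes x: "x \<in> \<X>" and Wb: "(W, b) \<in> \<Theta>" and t: "1 \<le> t"
    and \<theta>p: "\<theta> p = (W, b)"
    and \<theta>: "\<And>v r. t < r \<Longrightarrow> fst (\<theta> v) r = W r \<and> snd (\<theta> v) r = b r"
    and diff: "\<forall>r \<in> {t..T}. \<exists>D. has_jacobian s D (preact s (W, b) x r)"
    and base: "\<exists>J. has_jacobian (\<lambda>v. preact s (\<theta> v) x t) J p \<and> mat_bounded J c"
    and r: "t \<le> r" "r \<le> T + 1"
  shows "\<exists>J. has_jacobian (\<lambda>v. preact s (\<theta> v) x r) J p \<and> mat_bounded J ((S * U) ^ (r - t) * c)"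
  using r
proof (induction r rule: nat_induct_at_least)
  case base
  then show ?case using assms(7) by simp
next
  case (Suc r)
  then have r: "1 \<le> r" "r \<le> T" using t by auto
  define F where "F = (\<lambda>v. preact s (\<theta> v) x r)"
  obtain J where J: "has_jacobian F J p" "mat_bounded J ((S * U) ^ (r - t) * c)"
    using Suc by (auto simp: F_def)
  have Fp: "F p = preact s (W, b) x r" "F p \<in> carrier_vec (n r)"
    using preact_carrier [OF Wb x, of r] r by (auto simp: F_def \<theta>p)
  obtain D where D: "has_jacobian s D (F p)"
    using diff r Suc.hyps Fp(1) by (metis atLeastAtMost_iff)
  have DS: "mat_bounded D S"
    using D Fp(2) activation_lipschitz [OF r] by (rule jacobian_bounded_if_lipschitz)
  have sFp: "s (F p) \<in> carrier_vec (n r)" using activation_carrier r Fp by simp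
  note L = layer [OF Wb, of "Suc r", simplified]
  have W: "W (Suc r) \<in> carrier_mat (n (Suc r)) (n r)" "mat_bounded (W (Suc r)) U"
    and b: "b (Suc r) \<in> carrier_vec (n (Suc r))"
    using L r by auto
  have "has_jacobian (\<lambda>u. W (Suc r) *\<^sub>v u + b (Suc r)) (W (Suc r)) (s (F p))"
    using W(1) b sFp by (rule has_jacobian_affine) simp
  then have "has_jacobian (\<lambda>v. W (Suc r) *\<^sub>v s (F v) + b (Suc r)) (W (Suc r) * (D * J)) p"
    by (rule has_jacobian_compose [OF has_jacobian_compose [OF J(1) D]])
  moreover have "(\<lambda>v. preact s (\<theta> v) x (Suc r)) = (\<lambda>v. W (Suc r) *\<^sub>v s (F v) + b (Suc r))"
  proof
    fix v
    \<comment> \<open>Writing \<open>r\<close> as a successor lets the hidden state of layer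
      \<open>r\<close> unfold to the activation of its preactivation.\<close>
    obtain r' where "r = Suc r'" using r by (cases r) auto
    then show "preact s (\<theta> v) x (Suc r) = W (Suc r) *\<^sub>v s (F v) + b (Suc r)"
      using \<theta> [of "Suc r" v] Suc.hyps by (simp add: F_def preact_def)
  qed
  moreover have "mat_bounded (W (Suc r) * (D * J)) (U * (S * ((S * U) ^ (r - t) * c)))"
  proof -
    have Dc: "D \<in> carrier_mat (n r) (n r)" using D Fp sFp by (auto simp: has_jacobian_def)
    have Jc: "J \<in> carrier_mat (n r) (dim_vec p)" using J Fp by (auto simp: has_jacobian_def)
    show ?thesis
      using net_pos by (intro mat_bounded_mult [OF W(1) mult_carrier_mat [OF Dc Jc] W(2)]
          mat_bounded_mult [OF Dc Jc DS J(2)]) auto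
  qed
  \<comment> \<open>Because \<open>t \<le> r\<close>, the truncated difference
    \<open>Suc r - t\<close> is \<open>Suc (r - t)\<close>.\<close>
  moreover have "U * (S * ((S * U) ^ (r - t) * c)) = (S * U) ^ (Suc r - t) * c"
    using Suc.hyps by (simp add: Suc_diff_le)
  ultimately show ?case by metis
qed

lemma bias_jacobian:
  assumes x: "x \<in> \<X>" and Wb: "(W, b) \<in> \<Theta>" and t: "1 \<le> t" "t \<le> T + 1"
    and diff: "\<forall>r \<in> {t..T}. \<exists>D. has_jacobian s D (preact s (W, b) x r)"
  shows "\<exists>J. has_jacobian (\<lambda>v. network T s (W, b(t := v)) x) J (b t) \<and>
    spectral_norm J \<le> (S * U) ^ (T + 1 - t)"
proof -
  let ?\<theta> = "\<lambda>v. (W, b(t := v))" and ?h = "hidden s (W, b) x (t - 1)"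
  note L = layer [OF Wb t, simplified]
  have h: "?h \<in> carrier_vec (n (t - 1))" using hidden_carrier [OF Wb x] t by simp
  have hid: "hidden s (?\<theta> v) x (t - 1) = ?h" for v
    using t by (intro hidden_cong) auto
  \<comment> \<open>The starting bound for the propagation is \<open>c = 1\<close>; the constant
    part of the affine map is \<open>W t\<close> applied to the unchanged hidden state.\<close>
  have "has_jacobian (\<lambda>v. preact s (?\<theta> v) x t) (1\<^sub>m (n t)) (b t)"
  proof (rule has_jacobian_affine)
    show Wh: "W t *\<^sub>v ?h \<in> carrier_vec (n t)" using L h by simp
    show "preact s (?\<theta> y) x t = 1\<^sub>m (n t) *\<^sub>v y + W t *\<^sub>v ?h" if "y \<in> carrier_vec (n t)" for y
      using that Wh unfolding preact_def hid by (simp add: comm_add_vec [of _ "n t"])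
  qed (use L in auto)
  moreover have "mat_bounded (1\<^sub>m (n t)) 1" by (simp add: mat_bounded_def)
  ultimately have base: "\<exists>J. has_jacobian (\<lambda>v. preact s (?\<theta> v) x t) J (b t) \<and> mat_bounded J 1"
    by blast
  obtain J where "has_jacobian (\<lambda>v. preact s (?\<theta> v) x (T + 1)) J (b t)"
    "mat_bounded J ((S * U) ^ (T + 1 - t) * 1)"
    using preact_jacobian_propagate [of x W b t ?\<theta>, OF x Wb t(1) _ _ diff base t(2)] by auto
  then show ?thesis
    using net_pos by (auto simp: network_def intro!: spectral_norm_le)
qed

lemma weight_jacobian:
  assumes x: "x \<in> \<X>" and Wb: "(W, b) \<in> \<Theta>" and t: "1 \<le> t" "t \<le> T + 1"
    and diff: "\<forall>r \<in> {t..T}. \<exists>D. has_jacobian s D (preact s (W, b) x r)"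
  shows "\<exists>J. has_jacobian (\<lambda>w. network T s (W(t := mat_of_vec (n t) (n (t - 1)) w), b) x)
      J (vec_of_mat (W t)) \<and>
    spectral_norm J \<le> (S * U) ^ (T + 1 - t) * vec_norm (hidden s (W, b) x (t - 1))"
proof -
  let ?\<theta> = "\<lambda>w. (W(t := mat_of_vec (n t) (n (t - 1)) w), b)"
    and ?h = "hidden s (W, b) x (t - 1)" and ?p = "vec_of_mat (W t)"
  note L = layer [OF Wb t, simplified]
  have h: "?h \<in> carrier_vec (n (t - 1))" using hidden_carrier [OF Wb x] t by simp
  have hid: "hidden s (?\<theta> w) x (t - 1) = ?h" for w
    using t by (intro hidden_cong) auto
  obtain K where K: "K \<in> carrier_mat (n t) (n t * n (t - 1))" "mat_bounded K (vec_norm ?h)"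
    "\<And>w. w \<in> carrier_vec (n t * n (t - 1)) \<Longrightarrow> mat_of_vec (n t) (n (t - 1)) w *\<^sub>v ?h = K *\<^sub>v w"
    using mat_of_vec_mult_vec_linear [OF h] by metis
  have p: "?p \<in> carrier_vec (n t * n (t - 1))" using L(1) by (intro carrier_vecI) (auto simp: vec_of_mat_def)
  have "has_jacobian (\<lambda>w. preact s (?\<theta> w) x t) K ?p"
    using K(1) L(2) p
  proof (rule has_jacobian_affine)
    show "preact s (?\<theta> w) x t = K *\<^sub>v w + b t" if "w \<in> carrier_vec (n t * n (t - 1))" for w
      unfolding preact_def hid using K(3) [OF that] by simp
  qed
  with K(2) have base: "\<exists>J. has_jacobian (\<lambda>w. preact s (?\<theta> w) x t) J ?p \<and>
      mat_bounded J (vec_norm ?h)"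
    by blast
  \<comment> \<open>Reshaping undoes flattening, so the family meets the given parameters at the
    base point \<open>?p\<close>.\<close>
  have \<theta>p: "?\<theta> ?p = (W, b)" using L(1) by (simp add: mat_of_vec_of_mat)
  obtain J where "has_jacobian (\<lambda>w. preact s (?\<theta> w) x (T + 1)) J ?p"
    "mat_bounded J ((S * U) ^ (T + 1 - t) * vec_norm ?h)"
    using preact_jacobian_propagate [of x W b t ?\<theta>, OF x Wb t(1) \<theta>p _ diff base t(2)] by auto
  then show ?thesis
    using net_pos by (auto simp: network_def intro!: spectral_norm_le)
qed

section \<open>Lipschitz continuity in the parameters\<close>

text \<open>Supplies the bound on \<open>h'\<close> in \<open>(W - W') h'\<close>, uniform over
  \<open>\<Theta>\<close>. A bound \<open>H\<close> for one layer becomes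
  \<open>S * (U * H + \<bar>B\<bar>)\<close> for the next. The absolute value keeps this nonnegative
  even when \<open>\<Theta>\<close> is empty and \<open>B\<close> may be negative.\<close>

lemma hidden_bounded:
  assumes x: "x \<in> \<X>" and "t \<le> T"
  shows "\<exists>H \<ge> 0. \<forall>\<theta> \<in> \<Theta>. vec_norm (hidden s \<theta> x t) \<le> H"
  using assms(2)
proof (induction t)
  case 0
  then show ?case by (auto intro: exI [of _ "vec_norm x"])
next
  case (Suc t)
  then obtain H where H: "0 \<le> H" "\<And>\<theta>. \<theta> \<in> \<Theta> \<Longrightarrow> vec_norm (hidden s \<theta> x t) \<le> H" by auto
  have "vec_norm (hidden s \<theta> x (Suc t)) \<le> S * (U * H + \<bar>B\<bar>)" if \<theta>: "\<theta> \<in> \<Theta>" for \<theta>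
  proof -
    note L = layer [OF \<theta>, of "Suc t", simplified]
    let ?h = "hidden s \<theta> x t" and ?z = "preact s \<theta> x (Suc t)"
    have h: "?h \<in> carrier_vec (n t)" using hidden_carrier [OF \<theta> x] Suc by simp
    have z: "?z \<in> carrier_vec (n (Suc t))" using preact_carrier [OF \<theta> x] Suc by simp
    \<comment> \<open>Since the activation fixes zero, comparing \<open>?z\<close> with the zero
      vector turns Lipschitz continuity into a growth bound.\<close>
    have "s ?z - 0\<^sub>v (n (Suc t)) = s ?z" "?z - 0\<^sub>v (n (Suc t)) = ?z"
      using activation_carrier [of "Suc t" ?z] z Suc by auto
    then have "vec_norm (s ?z) \<le> S * vec_norm ?z"
      using activation_lipschitz [of "Suc t" ?z "0\<^sub>v (n (Suc t))"] z Suc activation_zero [of "Suc t"]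
      by simp
    also have "vec_norm ?z \<le> vec_norm (fst \<theta> (Suc t) *\<^sub>v ?h) + vec_norm (snd \<theta> (Suc t))"
      using L h Suc by (auto simp: preact_def intro!: vec_norm_add_le)
    also have "\<dots> \<le> U * vec_norm ?h + \<bar>B\<bar>"
      using mat_boundedD [OF L(3) L(1) h] L(4) Suc by (intro add_mono) auto
    also have "\<dots> \<le> U * H + \<bar>B\<bar>" using H(2) [OF \<theta>] net_pos by simp
    finally show ?thesis using net_pos by (simp only: hidden_Suc_preact) simp
  qed
  moreover have "0 \<le> S * (U * H + \<bar>B\<bar>)" using H net_pos by simp
  ultimately show ?case by blast
qed

lemma params_dist_ge:
  assumes "1 \<le> t" "t \<le> T + 1"
  shows "vec_norm (vec_of_mat (fst \<theta> t - fst \<theta>' t)) \<le> params_dist T \<theta> \<theta>'"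
    and "vec_norm (snd \<theta> t - snd \<theta>' t) \<le> params_dist T \<theta> \<theta>'"
proof -
  let ?f = "\<lambda>t. (vec_norm (vec_of_mat (fst \<theta> t - fst \<theta>' t)))\<^sup>2 + (vec_norm (snd \<theta> t - snd \<theta>' t))\<^sup>2"
  have "?f t \<le> sum ?f {1..T + 1}" using assms by (intro member_le_sum) auto
  then have "(vec_norm (vec_of_mat (fst \<theta> t - fst \<theta>' t)))\<^sup>2 \<le> sum ?f {1..T + 1}"
    "(vec_norm (snd \<theta> t - snd \<theta>' t))\<^sup>2 \<le> sum ?f {1..T + 1}"
    by (smt (verit) zero_le_power2)+
  then show "vec_norm (vec_of_mat (fst \<theta> t - fst \<theta>' t)) \<le> params_dist T \<theta> \<theta>'"
    and "vec_norm (snd \<theta> t - snd \<theta>' t) \<le> params_dist T \<theta> \<theta>'"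
    unfolding params_dist_def by (simp_all only: real_le_rsqrt)
qed

text \<open>The constant \<open>U * L + H + 1\<close> collects \<open>U * L\<close> from the change
  of the hidden state, \<open>H\<close> from the change of the weights and 1 from the change of the
  bias. The activation is left out so that the step also serves the output layer.\<close>

lemma preact_lipschitz_step:
  assumes x: "x \<in> \<X>" and t: "t \<le> T" and L: "0 \<le> L"
    and hid: "\<And>\<theta> \<theta>'. \<theta> \<in> \<Theta> \<Longrightarrow> \<theta>' \<in> \<Theta> \<Longrightarrow>
      vec_norm (hidden s \<theta> x t - hidden s \<theta>' x t) \<le> L * params_dist T \<theta> \<theta>'"
  shows "\<exists>M \<ge> 0. \<forall>\<theta> \<in> \<Theta>. \<forall>\<theta>' \<in> \<Theta>.
    vec_norm (preact s \<theta> x (Suc t) - preact s \<theta>' x (Suc t)) \<le> M * params_dist T \<theta> \<theta>'"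
proof -
  obtain H where H: "0 \<le> H" "\<And>\<theta>. \<theta> \<in> \<Theta> \<Longrightarrow> vec_norm (hidden s \<theta> x t) \<le> H"
    using hidden_bounded [OF x t] by auto
  have "vec_norm (preact s \<theta> x (Suc t) - preact s \<theta>' x (Suc t)) \<le> (U * L + H + 1) * params_dist T \<theta> \<theta>'"
    if \<theta>: "\<theta> \<in> \<Theta>" and \<theta>': "\<theta>' \<in> \<Theta>" for \<theta> \<theta>'
  proof -
    define W W' b b' h h' where "W = fst \<theta> (Suc t)" and "W' = fst \<theta>' (Suc t)"
      and "b = snd \<theta> (Suc t)" and "b' = snd \<theta>' (Suc t)"
      and "h = hidden s \<theta> x t" and "h' = hidden s \<theta>' x t"
    note defs = this
    let ?m = "n (Suc t)" and ?k = "n t" and ?d = "params_dist T \<theta> \<theta>'"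
    have W: "W \<in> carrier_mat ?m ?k" "W' \<in> carrier_mat ?m ?k" "mat_bounded W U"
      and b: "b \<in> carrier_vec ?m" "b' \<in> carrier_vec ?m"
      using layer [OF \<theta>, of "Suc t"] layer [OF \<theta>', of "Suc t"] t by (auto simp: defs)
    have h: "h \<in> carrier_vec ?k" "h' \<in> carrier_vec ?k"
      using hidden_carrier x t \<theta> \<theta>' by (auto simp: defs)
    have dist: "vec_norm (vec_of_mat (W - W')) \<le> ?d" "vec_norm (b - b') \<le> ?d"
      using params_dist_ge [of "Suc t" \<theta> \<theta>'] t by (auto simp: defs)
    have c: "W *\<^sub>v h \<in> carrier_vec ?m" "W *\<^sub>v h' \<in> carrier_vec ?m" "W' *\<^sub>v h' \<in> carrier_vec ?m"
      "W *\<^sub>v (h - h') \<in> carrier_vec ?m" "(W - W') *\<^sub>v h' \<in> carrier_vec ?m"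
      using W h by (auto intro!: mult_mat_vec_carrier [of _ _ ?k])
    have "W *\<^sub>v (h - h') = W *\<^sub>v h - W *\<^sub>v h'" "(W - W') *\<^sub>v h' = W *\<^sub>v h' - W' *\<^sub>v h'"
      using W h by (auto intro: mult_minus_distrib_mat_vec minus_mult_distrib_mat_vec)
    \<comment> \<open>Inserts the mixed term: \<open>q\<close> will be
      \<open>W *\<^sub>v h'\<close>.\<close>
    moreover have "(p + b) - (r + b') = (p - q) + ((q - r) + (b - b'))"
      if "p \<in> carrier_vec ?m" "q \<in> carrier_vec ?m" "r \<in> carrier_vec ?m" for p q r
      using that b by (intro eq_vecI) auto
    ultimately have "(W *\<^sub>v h + b) - (W' *\<^sub>v h' + b') = W *\<^sub>v (h - h') + ((W - W') *\<^sub>v h' + (b - b'))"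
      using c by metis
    then have "vec_norm ((W *\<^sub>v h + b) - (W' *\<^sub>v h' + b')) \<le>
        vec_norm (W *\<^sub>v (h - h')) + (vec_norm ((W - W') *\<^sub>v h') + vec_norm (b - b'))"
      using vec_norm_add_le [OF c(4), of "(W - W') *\<^sub>v h' + (b - b')"]
        vec_norm_add_le [OF c(5), of "b - b'"] c(5) b by auto
    also have "vec_norm (W *\<^sub>v (h - h')) \<le> U * vec_norm (h - h')"
      using W h by (intro mat_boundedD) auto
    also have "U * vec_norm (h - h') \<le> U * (L * ?d)"
      using hid [OF \<theta> \<theta>'] net_pos by (simp add: defs)
    also have "vec_norm ((W - W') *\<^sub>v h') \<le> vec_norm (vec_of_mat (W - W')) * vec_norm h'"
      using W h by (intro vec_norm_mult_mat_vec_le_frobenius) auto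
    also have "\<dots> \<le> ?d * H"
      using dist H(2) [OF \<theta>'] order_trans [OF vec_norm_nonneg dist(1)]
      by (intro mult_mono) (auto simp: defs)
    finally have "vec_norm ((W *\<^sub>v h + b) - (W' *\<^sub>v h' + b')) \<le> U * (L * ?d) + (?d * H + ?d)"
      using dist(2) by simp
    then show ?thesis by (simp add: preact_def defs algebra_simps)
  qed
  moreover have "0 \<le> U * L + H + 1" using H L net_pos by simp
  ultimately show ?thesis by blast
qed

lemma hidden_lipschitz:
  assumes x: "x \<in> \<X>" and "t \<le> T"
  shows "\<exists>L \<ge> 0. \<forall>\<theta> \<in> \<Theta>. \<forall>\<theta>' \<in> \<Theta>.
    vec_norm (hidden s \<theta> x t - hidden s \<theta>' x t) \<le> L * params_dist T \<theta> \<theta>'"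
  using assms(2)
proof (induction t)
  case 0
  \<comment> \<open>Layer 0 is the input itself, independent of the parameters, so the constant 0
    suffices.\<close>
  have "x - x = 0\<^sub>v (n 0)" using input [OF x] by auto
  then show ?case by (auto intro: exI [of _ 0])
next
  case (Suc t)
  then obtain L where "0 \<le> L" "\<And>\<theta> \<theta>'. \<theta> \<in> \<Theta> \<Longrightarrow> \<theta>' \<in> \<Theta> \<Longrightarrow>
      vec_norm (hidden s \<theta> x t - hidden s \<theta>' x t) \<le> L * params_dist T \<theta> \<theta>'"
    by (meson Suc_leD)
  then obtain M where M: "0 \<le> M" "\<And>\<theta> \<theta>'. \<theta> \<in> \<Theta> \<Longrightarrow> \<theta>' \<in> \<Theta> \<Longrightarrow>
      vec_norm (preact s \<theta> x (Suc t) - preact s \<theta>' x (Suc t)) \<le> M * params_dist T \<theta> \<theta>'"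
    using preact_lipschitz_step [OF x Suc_leD [OF Suc.prems]] by metis
  have "vec_norm (hidden s \<theta> x (Suc t) - hidden s \<theta>' x (Suc t)) \<le> (S * M) * params_dist T \<theta> \<theta>'"
    if "\<theta> \<in> \<Theta>" "\<theta>' \<in> \<Theta>" for \<theta> \<theta>'
  proof -
    have "vec_norm (hidden s \<theta> x (Suc t) - hidden s \<theta>' x (Suc t)) \<le>
        S * vec_norm (preact s \<theta> x (Suc t) - preact s \<theta>' x (Suc t))"
      unfolding hidden_Suc_preact
      using Suc.prems that x by (intro activation_lipschitz [of "Suc t"] preact_carrier) auto
    also have "\<dots> \<le> S * (M * params_dist T \<theta> \<theta>')"
      using M(2) [OF that] net_pos by simp
    finally show ?thesis by simp
  qed
  moreover have "0 \<le> S * M" using M net_pos by simp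
  ultimately show ?case by blast
qed

text \<open>The output layer has no activation, so one more affine step after the last hidden layer
  finishes the argument.\<close>

lemma network_lipschitz:
  assumes x: "x \<in> \<X>"
  shows "\<exists>L \<ge> 0. \<forall>\<theta> \<in> \<Theta>. \<forall>\<theta>' \<in> \<Theta>.
    vec_norm (network T s \<theta> x - network T s \<theta>' x) \<le> L * params_dist T \<theta> \<theta>'"
proof -
  obtain L where "0 \<le> L" "\<And>\<theta> \<theta>'. \<theta> \<in> \<Theta> \<Longrightarrow> \<theta>' \<in> \<Theta> \<Longrightarrow>
      vec_norm (hidden s \<theta> x T - hidden s \<theta>' x T) \<le> L * params_dist T \<theta> \<theta>'"
    using hidden_lipschitz [OF x order_refl] by metis
  from preact_lipschitz_step [OF x order_refl this] show ?thesis
    by (simp add: network_def)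
qed

end

text \<open>Differentiability of the activation is asked exactly at the preactivations that the
  chain rule passes through. Frechet derivatives on a full space are unique, so each existentially
  quantified \<open>J\<close> is the Jacobian.\<close>

theorem proposition4:
  fixes T :: nat and n :: "nat \<Rightarrow> nat" and s :: "real vec \<Rightarrow> real vec"
    and \<Theta> :: "params set" and \<X> :: "real vec set" and S U B X :: real
  assumes "lipschitz_network T n s \<Theta> \<X> S U B X"
  shows "(\<forall>t \<in> {1..T + 1}. \<forall>(W, b) \<in> \<Theta>. \<forall>x \<in> \<X>.
            (\<forall>r \<in> {t..T}. \<exists>D. has_jacobian s D (preact s (W, b) x r)) \<longrightarrow>
              (\<exists>J. has_jacobian (\<lambda>v. network T s (W, b(t := v)) x) J (b t) \<and>
                   spectral_norm J \<le> (S * U) ^ (T + 1 - t)) \<and>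
              (\<exists>J. has_jacobian
                     (\<lambda>w. network T s (W(t := mat_of_vec (n t) (n (t - 1)) w), b) x)
                     J (vec_of_mat (W t)) \<and>
                   spectral_norm J \<le> (S * U) ^ (T + 1 - t) * vec_norm (hidden s (W, b) x (t - 1))))
       \<and> (\<forall>x \<in> \<X>. \<exists>L \<ge> 0. \<forall>\<theta> \<in> \<Theta>. \<forall>\<theta>' \<in> \<Theta>.
            vec_norm (network T s \<theta> x - network T s \<theta>' x) \<le> L * params_dist T \<theta> \<theta>')"
proof (intro conjI ballI, clarify, intro conjI)
  fix t W b x
  assume "t \<in> {1..T + 1}" and Wb: "(W, b) \<in> \<Theta>" and x: "x \<in> \<X>"
    and diff: "\<forall>r \<in> {t..T}. \<exists>D. has_jacobian s D (preact s (W, b) x r)"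
  then have t: "1 \<le> t" "t \<le> T + 1" by auto
  show "\<exists>J. has_jacobian (\<lambda>v. network T s (W, b(t := v)) x) J (b t) \<and>
      spectral_norm J \<le> (S * U) ^ (T + 1 - t)"
    using assms x Wb t diff by (rule bias_jacobian)
  show "\<exists>J. has_jacobian (\<lambda>w. network T s (W(t := mat_of_vec (n t) (n (t - 1)) w), b) x)
      J (vec_of_mat (W t)) \<and>
      spectral_norm J \<le> (S * U) ^ (T + 1 - t) * vec_norm (hidden s (W, b) x (t - 1))"
    using assms x Wb t diff by (rule weight_jacobian)
next
  fix x assume "x \<in> \<X>"
  with assms show "\<exists>L \<ge> 0. \<forall>\<theta> \<in> \<Theta>. \<forall>\<theta>' \<in> \<Theta>.
      vec_norm (network T s \<theta> x - network T s \<theta>' x) \<le> L * params_dist T \<theta> \<theta>'"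
    by (rule network_lipschitz)
qed

end
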